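(* Let $b$ and $n$ be positive integers. If $G$ is a graph on $n$ vertices with minimum degree $\delta(G)>\log_{b+1}(n)-1$, then Dominator wins the $b$-biased Maker-Breaker domination game on $G$ when she is the first player. Moreover, for infinitely many $n$ there is a graph $G$ on $n$ vertices with $\delta(G)>\log_{b+1}(n)-2$ such that Staller wins the $b$-biased Maker-Breaker domination game on $G$ when Dominator is the first player.
   Context: The $b$-biased Maker-Breaker domination game on a finite graph $G$: Dominator and Staller alternately claim previously unclaimed vertices of $G$; in each of her turns Dominator claims up to $b$ vertices, in each of his turns Staller claims one vertex. Dominator wins if the set of vertices she claims contains a dominating set of $G$ (a set $D$ such that every vertex outside $D$ has a neighbour in $D$); otherwise Staller wins. *)

theory Defs
  imports Complex_Main
begin

definition simple_graph :: "'a set \<Rightarrow> 'a set set \<Rightarrow> bool" where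
  "simple_graph V E \<longleftrightarrow> finite V \<and> (\<forall>e\<in>E. e \<subseteq> V \<and> card e = 2)"

definition degree :: "'a set set \<Rightarrow> 'a \<Rightarrow> nat" where
  "degree E v = card {u. {u, v} \<in> E}"

text \<open>Only meaningful for a finite nonempty vertex set.\<close>
definition min_degree :: "'a set \<Rightarrow> 'a set set \<Rightarrow> nat" where
  "min_degree V E = Min (degree E ` V)"

definition dominating_set :: "'a set \<Rightarrow> 'a set set \<Rightarrow> 'a set \<Rightarrow> bool" where
  "dominating_set V E D \<longleftrightarrow> D \<subseteq> V \<and> (\<forall>v \<in> V - D. \<exists>u\<in>D. {u, v} \<in> E)"

datatype player = Dominator | Staller

text \<open>
  A (possibly unfinished) play is the list of moves made so far, a move being the set of vertices
  claimed in one turn. Dominator is the first player, so the moves with even index are hers.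
  "Up to \<open>b\<close> vertices" includes the empty move; the game still ends, because Staller claims
  exactly one vertex in each of his turns. No move is made once all vertices are claimed.
\<close>

definition turn :: "nat \<Rightarrow> player" where
  "turn i = (if even i then Dominator else Staller)"

definition claimed :: "'a set list \<Rightarrow> 'a set" where
  "claimed ms = \<Union> (set ms)"

definition claimed_by :: "player \<Rightarrow> 'a set list \<Rightarrow> 'a set" where
  "claimed_by p ms = (\<Union>i \<in> {i. i < length ms \<and> turn i = p}. ms ! i)"

definition legal_size :: "nat \<Rightarrow> player \<Rightarrow> nat \<Rightarrow> bool" where
  "legal_size b p k \<longleftrightarrow> (case p of Dominator \<Rightarrow> k \<le> b | Staller \<Rightarrow> k = 1)"

definition legal_play :: "'a set \<Rightarrow> nat \<Rightarrow> 'a set list \<Rightarrow> bool" where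
  "legal_play V b ms \<longleftrightarrow>
     (\<forall>i < length ms. claimed (take i ms) \<noteq> V \<and>
        ms ! i \<subseteq> V - claimed (take i ms) \<and> legal_size b (turn i) (card (ms ! i)))"

definition finished_play :: "'a set \<Rightarrow> nat \<Rightarrow> 'a set list \<Rightarrow> bool" where
  "finished_play V b ms \<longleftrightarrow> legal_play V b ms \<and> claimed ms = V"

definition won_by :: "'a set \<Rightarrow> 'a set set \<Rightarrow> player \<Rightarrow> 'a set list \<Rightarrow> bool" where
  "won_by V E p ms \<longleftrightarrow>
     (case p of
        Dominator \<Rightarrow> \<exists>D \<subseteq> claimed_by Dominator ms. dominating_set V E D
      | Staller \<Rightarrow> \<not> (\<exists>D \<subseteq> claimed_by Dominator ms. dominating_set V E D))"

definition follows :: "player \<Rightarrow> ('a set list \<Rightarrow> 'a set) \<Rightarrow> 'a set list \<Rightarrow> bool" where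
  "follows p \<sigma> ms \<longleftrightarrow> (\<forall>i < length ms. turn i = p \<longrightarrow> ms ! i = \<sigma> (take i ms))"

text \<open>
  A strategy maps the history of the play to the next move. A winning strategy must prescribe a
  legal move whenever it is consulted, and win every finished play that follows it.
\<close>
definition winning_strategy ::
  "'a set \<Rightarrow> 'a set set \<Rightarrow> nat \<Rightarrow> player \<Rightarrow> ('a set list \<Rightarrow> 'a set) \<Rightarrow> bool" where
  "winning_strategy V E b p \<sigma> \<longleftrightarrow>
     (\<forall>ms. legal_play V b ms \<and> claimed ms \<noteq> V \<and> follows p \<sigma> ms \<and> turn (length ms) = p
        \<longrightarrow> legal_play V b (ms @ [\<sigma> ms])) \<and>
     (\<forall>ms. finished_play V b ms \<and> follows p \<sigma> ms \<longrightarrow> won_by V E p ms)"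

definition wins_dominator_first :: "'a set \<Rightarrow> 'a set set \<Rightarrow> nat \<Rightarrow> player \<Rightarrow> bool" where
  "wins_dominator_first V E b p \<longleftrightarrow> (\<exists>\<sigma>. winning_strategy V E b p \<sigma>)"

end

theory Submission
  imports Defs "HOL-Library.Nat_Bijection" "HOL-Library.Sublist"
begin

text \<open>
  Dominator has to claim a vertex of every closed neighbourhood. She uses the potential function of
  Erdos--Selfridge and Beck: a closed neighbourhood not yet hit and with \<open>m\<close> unclaimed vertices has
  weight \<open>(b + 1) ^ (-m)\<close>. Claiming \<open>b\<close> vertices greedily removes at least \<open>b\<close> times
  the weight through any vertex that remains, whereas Staller's reply \<open>x\<close> adds \<open>b\<close> times
  the weight through \<open>x\<close>; hence the total weight never reaches \<open>1\<close>.

  For sharpness take \<open>b + 1\<close> disjoint complete \<open>(b + 1)\<close>-ary trees with \<open>k\<close> levels, and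
  join every vertex to all its ancestors. Each turn of Dominator misses one of the \<open>b + 1\<close>
  subtrees below Staller's current vertex, so Staller claims a whole path from a root to a leaf, which
  is the closed neighbourhood of that leaf.
\<close>

section \<open>Plays and strategies\<close>

lemma claimed_Nil [simp]: "claimed [] = {}"
  by (simp add: claimed_def)

lemma claimed_snoc [simp]: "claimed (ms @ [X]) = claimed ms \<union> X"
  by (auto simp: claimed_def)

lemma claimed_by_Nil [simp]: "claimed_by p [] = {}"
  by (simp add: claimed_by_def)

lemma claimed_by_snoc [simp]:
  "claimed_by p (ms @ [X]) = claimed_by p ms \<union> (if turn (length ms) = p then X else {})"
  by (auto simp: claimed_by_def nth_append less_Suc_eq split: if_splits)

lemma claimed_by_subset: "claimed_by p ms \<subseteq> claimed ms"
  by (force simp: claimed_by_def claimed_def)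

lemma legal_play_Nil [simp]: "legal_play V b []"
  by (simp add: legal_play_def)

lemma legal_play_snoc:
  "legal_play V b (ms @ [X]) \<longleftrightarrow> legal_play V b ms \<and> claimed ms \<noteq> V \<and>
     X \<subseteq> V - claimed ms \<and> legal_size b (turn (length ms)) (card X)"
  by (auto simp: legal_play_def nth_append less_Suc_eq)

lemma follows_snoc:
  "follows p \<sigma> (ms @ [X]) \<longleftrightarrow> follows p \<sigma> ms \<and> (turn (length ms) = p \<longrightarrow> X = \<sigma> ms)"
  by (auto simp: follows_def nth_append less_Suc_eq)

lemma legal_play_subset: "legal_play V b ms \<Longrightarrow> claimed ms \<subseteq> V"
  by (induction ms rule: rev_induct) (auto simp: legal_play_snoc)

lemma turn_Suc: "turn (Suc n) = Dominator \<longleftrightarrow> turn n = Staller"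
  by (simp add: turn_def)

lemma player_neq_Staller: "p \<noteq> Staller \<longleftrightarrow> p = Dominator"
  by (cases p) auto

lemma player_neq_Dominator: "p \<noteq> Dominator \<longleftrightarrow> p = Staller"
  by (cases p) auto

text \<open>Spares both players an explicit strategy: a legal move preserving \<open>I\<close> is
  picked by choice, so \<open>I\<close> holds along every play that follows these picks.\<close>

lemma winning_strategy_if_invariant:
  assumes init: "I []"
    and other: "\<And>ms X. legal_play V b (ms @ [X]) \<Longrightarrow> turn (length ms) \<noteq> p \<Longrightarrow> I ms \<Longrightarrow> I (ms @ [X])"
    and own: "\<And>ms. legal_play V b ms \<Longrightarrow> claimed ms \<noteq> V \<Longrightarrow> turn (length ms) = p \<Longrightarrow> I ms \<Longrightarrow>
      \<exists>X. legal_play V b (ms @ [X]) \<and> I (ms @ [X])"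
    and final: "\<And>ms. finished_play V b ms \<Longrightarrow> I ms \<Longrightarrow> won_by V E p ms"
  shows "wins_dominator_first V E b p"
proof -
  define \<sigma> where "\<sigma> ms = (SOME X. legal_play V b (ms @ [X]) \<and> I (ms @ [X]))" for ms
  have \<sigma>: "legal_play V b (ms @ [\<sigma> ms]) \<and> I (ms @ [\<sigma> ms])"
    if "legal_play V b ms" "claimed ms \<noteq> V" "turn (length ms) = p" "I ms" for ms
    unfolding \<sigma>_def by (rule someI_ex) (rule own[OF that])
  have I: "I ms" if "legal_play V b ms" "follows p \<sigma> ms" for ms
    using that
  proof (induction ms rule: rev_induct)
    case Nil
    show ?case by (rule init)
  next
    case (snoc X ms)
    then have "I ms" by (simp add: legal_play_snoc follows_snoc)
    then show ?case
      using snoc.prems other \<sigma> by (cases "turn (length ms) = p") (auto simp: legal_play_snoc follows_snoc)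
  qed
  have "winning_strategy V E b p \<sigma>"
    using I \<sigma> final by (auto simp: winning_strategy_def finished_play_def)
  then show ?thesis
    by (auto simp: wins_dominator_first_def)
qed


section \<open>The potential function\<close>

definition unhit :: "'i set \<Rightarrow> ('i \<Rightarrow> 'a set) \<Rightarrow> 'a set \<Rightarrow> 'i set" where
  "unhit A N D = {v \<in> A. N v \<inter> D = {}}"

text \<open>\<open>D\<close> stands for Dominator's vertices, \<open>C\<close> for those claimed by
  either player. Summing over indices counts equal neighbourhoods of different vertices
  separately.\<close>

definition potential :: "real \<Rightarrow> 'i set \<Rightarrow> ('i \<Rightarrow> 'a set) \<Rightarrow> 'a set \<Rightarrow> 'a set \<Rightarrow> real" where
  "potential q A N D C = (\<Sum>v \<in> unhit A N D. (1 / q) ^ card (N v - C))"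

text \<open>The common currency of a move at a free vertex \<open>x\<close>: Dominator's claim
  removes this much potential, Staller's adds \<open>q - 1\<close> times as much.\<close>

definition weight :: "real \<Rightarrow> 'i set \<Rightarrow> ('i \<Rightarrow> 'a set) \<Rightarrow> 'a set \<Rightarrow> 'a set \<Rightarrow> 'a \<Rightarrow> real" where
  "weight q A N D C x = (\<Sum>v \<in> {v \<in> unhit A N D. x \<in> N v}. (1 / q) ^ card (N v - C))"

context
  fixes q :: real and A :: "'i set" and N :: "'i \<Rightarrow> 'a set"
  assumes q: "q > 0" and finite_A: "finite A" and finite_N: "\<forall>v \<in> A. finite (N v)"
begin

lemma finite_unhit: "finite (unhit A N D)"
  using finite_A by (simp add: unhit_def)

lemma weight_nonneg: "weight q A N D C x \<ge> 0"
  using q by (simp add: weight_def sum_nonneg)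

text \<open>Sets through \<open>y\<close> drop out of the sum; the others do not contain
  \<open>y\<close>, so their numbers of free vertices stay the same.\<close>

lemma potential_hit:
  "potential q A N (insert y D) (insert y C) = potential q A N D C - weight q A N D C y"
proof -
  have unhit: "unhit A N (insert y D) = unhit A N D - {v \<in> unhit A N D. y \<in> N v}"
    by (auto simp: unhit_def)
  have "potential q A N (insert y D) (insert y C) =
      (\<Sum>v \<in> unhit A N (insert y D). (1 / q) ^ card (N v - C))"
    unfolding potential_def
  proof (rule sum.cong)
    fix v assume "v \<in> unhit A N (insert y D)"
    then have "N v - insert y C = N v - C" by (auto simp: unhit_def)
    then show "(1 / q) ^ card (N v - insert y C) = (1 / q) ^ card (N v - C)" by simp
  qed simp
  then show ?thesis
    unfolding unhit by (simp add: potential_def weight_def sum_diff finite_unhit)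
qed

text \<open>Sets still unhit avoid \<open>y\<close>, so their terms are unchanged, and no new terms
  appear. Hence later claims of Dominator never undo what an earlier greedy choice achieved.\<close>

lemma weight_hit_le: "weight q A N (insert y D) (insert y C) x \<le> weight q A N D C x"
proof -
  have "weight q A N (insert y D) (insert y C) x =
      (\<Sum>v \<in> {v \<in> unhit A N (insert y D). x \<in> N v}. (1 / q) ^ card (N v - C))"
    unfolding weight_def
  proof (rule sum.cong)
    fix v assume "v \<in> {v \<in> unhit A N (insert y D). x \<in> N v}"
    then have "N v - insert y C = N v - C" by (auto simp: unhit_def)
    then show "(1 / q) ^ card (N v - insert y C) = (1 / q) ^ card (N v - C)" by simp
  qed simp
  also have "\<dots> \<le> weight q A N D C x"
    unfolding weight_def using q finite_A by (intro sum_mono2) (auto simp: unhit_def)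
  finally show ?thesis .
qed

text \<open>Each unhit set through \<open>y\<close> loses one free vertex, which multiplies its term
  by \<open>q\<close>.\<close>

lemma potential_claim:
  assumes "y \<notin> C"
  shows "potential q A N D (insert y C) = potential q A N D C + (q - 1) * weight q A N D C y"
proof -
  let ?P = "\<lambda>C v. (1 / q) ^ card (N v - C)"
  let ?U = "unhit A N D" and ?W = "{v \<in> unhit A N D. y \<in> N v}"
  have split: "potential q A N D C = sum (?P C) (?U - ?W) + sum (?P C) ?W" for C
    unfolding potential_def using finite_unhit by (intro sum.subset_diff) auto
  have "sum (?P (insert y C)) (?U - ?W) = sum (?P C) (?U - ?W)"
  proof (rule sum.cong)
    fix v assume "v \<in> ?U - ?W"
    then have "N v - insert y C = N v - C" by auto
    then show "?P (insert y C) v = ?P C v" by simp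
  qed simp
  moreover have "sum (?P (insert y C)) ?W = (\<Sum>v\<in>?W. q * ?P C v)"
  proof (rule sum.cong)
    fix v assume v: "v \<in> ?W"
    then have "finite (N v)" using finite_N by (auto simp: unhit_def)
    moreover have "N v - C = insert y (N v - insert y C)" using v assms by auto
    ultimately have "card (N v - C) = Suc (card (N v - insert y C))"
      by (metis Diff_iff card_insert_disjoint finite_Diff insertI1)
    then show "?P (insert y C) v = q * ?P C v" using q by simp
  qed simp
  ultimately show ?thesis
    using split[of C] split[of "insert y C"]
    by (simp add: weight_def sum_distrib_left[symmetric] algebra_simps)
qed

text \<open>Always claim a vertex of maximal weight. Weights never rise during the turn, so each of
  \<open>k\<close> claims removes at least the final weight of any \<open>x\<close> left over. For
  \<open>k = q - 1\<close> the bound absorbs Staller's gain at \<open>x\<close>.\<close>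

lemma greedy_claim:
  assumes "finite U"
  shows "\<exists>Y \<subseteq> U. card Y \<le> k \<and> potential q A N (D \<union> Y) (C \<union> Y) \<le> potential q A N D C \<and>
    (\<forall>x \<in> U - Y. potential q A N (D \<union> Y) (C \<union> Y) + k * weight q A N (D \<union> Y) (C \<union> Y) x
      \<le> potential q A N D C)"
proof (induction k)
  case 0
  show ?case by (rule exI[of _ "{}"]) simp
next
  case (Suc k)
  then obtain Y where Y: "Y \<subseteq> U" "card Y \<le> k"
    "potential q A N (D \<union> Y) (C \<union> Y) \<le> potential q A N D C"
    "\<And>x. x \<in> U - Y \<Longrightarrow> potential q A N (D \<union> Y) (C \<union> Y) + k * weight q A N (D \<union> Y) (C \<union> Y) x
      \<le> potential q A N D C"
    by blast
  let ?w = "weight q A N (D \<union> Y) (C \<union> Y)"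
  show ?case
  proof (cases "U - Y = {}")
    case True
    \<comment> \<open>\<open>U\<close> is exhausted, so the bound on leftover vertices is
      vacuous.\<close>
    then show ?thesis using Y by (intro exI[of _ Y]) auto
  next
    case False
    moreover have "finite (U - Y)" using assms by simp
    ultimately have "Max (?w ` (U - Y)) \<in> ?w ` (U - Y)"
      by (intro Max_in) auto
    then obtain y where y: "y \<in> U - Y" "?w y = Max (?w ` (U - Y))"
      by auto
    then have max: "?w x \<le> ?w y" if "x \<in> U - Y" for x
      using that assms by simp
    have hit: "potential q A N (D \<union> insert y Y) (C \<union> insert y Y) = potential q A N (D \<union> Y) (C \<union> Y) - ?w y"
      by (simp add: potential_hit)
    show ?thesis
    proof (intro exI[of _ "insert y Y"] conjI ballI)
      show "insert y Y \<subseteq> U" using y Y by auto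
      show "card (insert y Y) \<le> Suc k"
        using Y(2) y(1) finite_subset[OF Y(1) assms] by simp
      show "potential q A N (D \<union> insert y Y) (C \<union> insert y Y) \<le> potential q A N D C"
        using Y(3) weight_nonneg[of "D \<union> Y" "C \<union> Y" y] unfolding hit by linarith
      fix x assume "x \<in> U - insert y Y"
      then have x: "x \<in> U - Y" by simp
      have "weight q A N (D \<union> insert y Y) (C \<union> insert y Y) x \<le> ?w x"
        using weight_hit_le[of y "D \<union> Y" "C \<union> Y" x] by simp
      then have "Suc k * weight q A N (D \<union> insert y Y) (C \<union> insert y Y) x \<le> Suc k * ?w x"
        by (intro mult_left_mono) auto
      \<comment> \<open>One copy of \<open>?w x\<close> is covered by the loss \<open>?w y\<close>
        of the new claim, the other \<open>k\<close> copies by \<open>Y(4)\<close>.\<close>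
      also have "\<dots> \<le> k * ?w x + ?w y"
        using max[OF x] by (simp add: algebra_simps)
      finally show "potential q A N (D \<union> insert y Y) (C \<union> insert y Y) +
          Suc k * weight q A N (D \<union> insert y Y) (C \<union> insert y Y) x \<le> potential q A N D C"
        using Y(4)[OF x] unfolding hit by linarith
    qed
  qed
qed

end


section \<open>Dominator's strategy\<close>

definition closed_nbhd :: "'a set set \<Rightarrow> 'a \<Rightarrow> 'a set" where
  "closed_nbhd E v = insert v {u. {u, v} \<in> E}"

lemma closed_nbhd_subset:
  "simple_graph V E \<Longrightarrow> v \<in> V \<Longrightarrow> closed_nbhd E v \<subseteq> V"
  by (auto simp: simple_graph_def closed_nbhd_def)

lemma card_closed_nbhd:
  assumes "simple_graph V E" "v \<in> V"
  shows "card (closed_nbhd E v) = Suc (degree E v)"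
proof -
  have "finite {u. {u, v} \<in> E}"
    using closed_nbhd_subset[OF assms] assms(1)
    by (auto simp: closed_nbhd_def simple_graph_def intro: finite_subset)
  moreover have "v \<notin> {u. {u, v} \<in> E}"
    using assms(1) by (auto simp: simple_graph_def)
  ultimately show ?thesis
    by (simp add: closed_nbhd_def degree_def)
qed

lemma dominating_set_if_hits:
  assumes "D \<subseteq> V" "\<And>v. v \<in> V \<Longrightarrow> closed_nbhd E v \<inter> D \<noteq> {}"
  shows "dominating_set V E D"
  using assms by (fastforce simp: dominating_set_def closed_nbhd_def)

text \<open>At the end no vertex is free, so a neighbourhood left unhit would contribute 1 by
  itself; keeping the potential below 1 is therefore enough.\<close>

lemma Dominator_wins_if_potential:
  assumes graph: "simple_graph V E"
    and init: "potential (real b + 1) V (closed_nbhd E) {} {} < 1"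
  shows "wins_dominator_first V E b Dominator"
proof -
  let ?pot = "potential (real b + 1) V (closed_nbhd E)"
  let ?w = "weight (real b + 1) V (closed_nbhd E)"
  let ?D = "claimed_by Dominator"
  have finV: "finite V" using graph by (simp add: simple_graph_def)
  have finN: "\<forall>v \<in> V. finite (closed_nbhd E v)"
    using closed_nbhd_subset[OF graph] finV by (blast intro: finite_subset)
  have q: "real b + 1 > 0" by simp
  note claim = potential_claim[OF q finV finN] and greedy = greedy_claim[OF q finV finN]
  \<comment> \<open>The second half looks one move ahead: on Staller's turn the bound must survive
    each of his possible replies.\<close>
  define I where "I ms \<longleftrightarrow> ?pot (?D ms) (claimed ms) < 1 \<and>
      (turn (length ms) = Staller \<longrightarrow>
        (\<forall>x \<in> V - claimed ms. ?pot (?D ms) (insert x (claimed ms)) < 1))" for ms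
  show ?thesis
  proof (rule winning_strategy_if_invariant[of I])
    show "I []" using init by (simp add: I_def turn_def)
  next
    fix ms X
    assume *: "legal_play V b (ms @ [X])" "turn (length ms) \<noteq> Dominator" "I ms"
    then have turn: "turn (length ms) = Staller" by (simp add: player_neq_Dominator)
    with * obtain x where "X = {x}" "x \<in> V - claimed ms"
      by (auto simp: legal_play_snoc legal_size_def card_1_singleton_iff)
    with * turn show "I (ms @ [X])"
      using turn_Suc[of "length ms"] by (simp add: I_def)
  next
    fix ms
    assume *: "legal_play V b ms" "claimed ms \<noteq> V" "turn (length ms) = Dominator" "I ms"
    have "finite (V - claimed ms)" using finV by simp
    from greedy[OF this, where k = b and D = "?D ms" and C = "claimed ms"] obtain Y where
      Y: "Y \<subseteq> V - claimed ms" "card Y \<le> b"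
      "?pot (?D ms \<union> Y) (claimed ms \<union> Y) \<le> ?pot (?D ms) (claimed ms)"
      "\<And>x. x \<in> V - claimed ms - Y \<Longrightarrow>
        ?pot (?D ms \<union> Y) (claimed ms \<union> Y) + b * ?w (?D ms \<union> Y) (claimed ms \<union> Y) x
        \<le> ?pot (?D ms) (claimed ms)"
      by blast
    have "legal_play V b (ms @ [Y])"
      using * Y by (simp add: legal_play_snoc legal_size_def)
    moreover have "I (ms @ [Y])"
    proof -
      \<comment> \<open>Here \<open>q - 1 = b\<close>, so Staller's gain at \<open>x\<close> is
        exactly the term included in the greedy bound.\<close>
      have "?pot (?D ms \<union> Y) (insert x (claimed ms \<union> Y)) < 1" if "x \<in> V - claimed ms - Y" for x
        using Y(4)[OF that] that * claim[of x "claimed ms \<union> Y" "?D ms \<union> Y"] by (auto simp: I_def)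
      then show ?thesis
        using * Y(3) by (auto simp: I_def)
    qed
    ultimately show "\<exists>X. legal_play V b (ms @ [X]) \<and> I (ms @ [X])" by blast
  next
    fix ms
    assume *: "finished_play V b ms" "I ms"
    then have C: "claimed ms = V" by (simp add: finished_play_def)
    have "unhit V (closed_nbhd E) (?D ms) = {}"
    proof (rule ccontr)
      assume "unhit V (closed_nbhd E) (?D ms) \<noteq> {}"
      moreover have "finite (unhit V (closed_nbhd E) (?D ms))"
        using finV by (simp add: unhit_def)
      moreover have "?pot (?D ms) V = card (unhit V (closed_nbhd E) (?D ms))"
      proof -
        have "card (closed_nbhd E v - V) = 0" if "v \<in> unhit V (closed_nbhd E) (?D ms)" for v
          using closed_nbhd_subset[OF graph, of v] that by (simp add: unhit_def Diff_eq_empty_iff[THEN iffD2])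
        then have "?pot (?D ms) V = (\<Sum>v \<in> unhit V (closed_nbhd E) (?D ms). 1)"
          unfolding potential_def by (intro sum.cong) simp_all
        then show ?thesis by simp
      qed
      ultimately have "?pot (?D ms) V \<ge> 1"
        by (simp add: Suc_leI card_gt_0_iff)
      then show False using * C by (simp add: I_def)
    qed
    then have "dominating_set V E (?D ms)"
      using claimed_by_subset[of Dominator ms] C
      by (intro dominating_set_if_hits) (auto simp: unhit_def)
    then show "won_by V E Dominator ms" by (auto simp: won_by_def)
  qed
qed

text \<open>A closed neighbourhood has at least \<open>?d + 1\<close> vertices, so the initial
  potential is at most \<open>card V / ?q ^ Suc ?d\<close>; the degree hypothesis says that this is
  below 1.\<close>

lemma Dominator_wins_if_min_degree:
  assumes graph: "simple_graph V E" and "V \<noteq> {}" and "b > 0"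
    and deg: "real (min_degree V E) > log (real (b + 1)) (real (card V)) - 1"
  shows "wins_dominator_first V E b Dominator"
proof (rule Dominator_wins_if_potential[OF graph])
  let ?d = "min_degree V E" and ?q = "real b + 1"
  have finV: "finite V" using graph by (simp add: simple_graph_def)
  have q: "?q > 1" using \<open>b > 0\<close> by simp
  have n: "card V > 0" using finV \<open>V \<noteq> {}\<close> by (simp add: card_gt_0_iff)
  have "potential ?q V (closed_nbhd E) {} {} = (\<Sum>v\<in>V. (1 / ?q) ^ Suc (degree E v))"
    by (simp add: potential_def unhit_def card_closed_nbhd[OF graph])
  also have "\<dots> \<le> (\<Sum>v\<in>V. (1 / ?q) ^ Suc ?d)"
  proof (rule sum_mono)
    fix v assume "v \<in> V"
    then have "?d \<le> degree E v"
      using finV by (simp add: min_degree_def)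
    then show "(1 / ?q) ^ Suc (degree E v) \<le> (1 / ?q) ^ Suc ?d"
      by (intro power_decreasing) (auto simp: divide_simps)
  qed
  also have "\<dots> = card V / ?q ^ Suc ?d"
    by (simp add: power_one_over divide_simps)
  also have "\<dots> < 1"
  proof -
    have "log ?q (card V) < real (Suc ?d)" using deg by (simp add: add.commute)
    then have "card V < ?q powr real (Suc ?d)"
      using q n by (subst (asm) log_less_iff) auto
    then have "card V < ?q ^ Suc ?d"
      using q by (subst (asm) powr_realpow) auto
    then show ?thesis using q by (subst divide_less_eq_1_pos) auto
  qed
  finally show "potential ?q V (closed_nbhd E) {} {} < 1" .
qed


section \<open>Staller's strategy on a forest\<close>

text \<open>A vertex is the list of child choices leading to it, so its ancestors are its nonempty
  strict prefixes. Dropping the empty list splits a single tree into \<open>b + 1\<close> trees with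
  \<open>k\<close> levels.\<close>

definition forest :: "nat \<Rightarrow> nat \<Rightarrow> nat list set" where
  "forest b k = {xs. set xs \<subseteq> {..b} \<and> length xs \<le> k} - {[]}"

text \<open>The map \<open>f\<close>, injective in all uses, renames lists, so that the graph can
  live on another vertex type such as \<open>nat\<close>.\<close>

definition forest_edges :: "(nat list \<Rightarrow> 'a) \<Rightarrow> nat \<Rightarrow> nat \<Rightarrow> 'a set set" where
  "forest_edges f b k = {{f xs, f ys} | xs ys. xs \<in> forest b k \<and> ys \<in> forest b k \<and> strict_prefix xs ys}"

section \<open>Size, adjacency and degrees of the forest\<close>

lemma finite_forest: "finite (forest b k)"
  by (simp add: forest_def finite_lists_length_le)

lemma card_forest: "card (forest b k) = (\<Sum>i\<le>k. (b + 1) ^ i) - 1"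
proof -
  have "card (forest b k) = card {xs. set xs \<subseteq> {..b} \<and> length xs \<le> k} - 1"
    unfolding forest_def by (subst card_Diff_singleton) auto
  then show ?thesis by (simp add: card_lists_length_le)
qed

text \<open>The doubling in the induction is absorbed by \<open>b + 1 \<ge> 2\<close>; strictness
  comes from the excluded empty list.\<close>

lemma card_forest_less:
  assumes "b > 0"
  shows "card (forest b k) < (b + 1) ^ (k + 1)"
proof -
  have "(\<Sum>i\<le>k. (b + 1) ^ i) \<le> (b + 1) ^ (k + 1)"
  proof (induction k)
    case (Suc k)
    have "(\<Sum>i\<le>Suc k. (b + 1) ^ i) \<le> 2 * (b + 1) ^ (k + 1)"
      using Suc by simp
    also have "\<dots> \<le> (b + 1) * (b + 1) ^ (k + 1)"
      using assms by (intro mult_right_mono) auto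
    finally show ?case by simp
  qed simp
  moreover have "(b + 1) ^ (k + 1) > 0" by simp
  ultimately show ?thesis unfolding card_forest by linarith
qed

text \<open>A crude count of one vertex per level; it yields nonemptiness and arbitrarily large
  orders.\<close>

lemma card_forest_ge: "k \<le> card (forest b k)"
proof -
  have "(\<Sum>i\<le>k. 1) \<le> (\<Sum>i\<le>k. (b + 1) ^ i)"
    by (intro sum_mono) simp
  then show ?thesis unfolding card_forest by simp
qed

lemma simple_graph_forest:
  assumes "inj f"
  shows "simple_graph (f ` forest b k) (forest_edges f b k)"
  using assms by (auto simp: simple_graph_def forest_edges_def card_insert_if inj_eq finite_forest)

lemma forest_edge_iff:
  assumes "inj f"
  shows "{f xs, f ys} \<in> forest_edges f b k \<longleftrightarrow>
    xs \<in> forest b k \<and> ys \<in> forest b k \<and> (strict_prefix xs ys \<or> strict_prefix ys xs)"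
  using assms by (auto simp: forest_edges_def doubleton_eq_iff inj_eq)

lemma degree_forest_ge:
  assumes f: "inj f" and xs: "xs \<in> forest b k"
  shows "k - 1 \<le> degree (forest_edges f b k) (f xs)"
proof -
  \<comment> \<open>One neighbour on each level \<open>j\<close> other than that of
    \<open>xs\<close>: the ancestor there, or the descendant reached by always taking child 0.
    Distinct lengths make these distinct.\<close>
  define g where "g j = take j xs @ replicate (j - length xs) 0" for j
  have len: "length (g j) = j" for j
    by (simp add: g_def)
  have "inj_on (f \<circ> g) ({1..k} - {length xs})"
    by (rule inj_onI) (metis comp_apply f injD len)
  moreover have "length xs \<in> {1..k}"
    using xs by (cases xs) (auto simp: forest_def)
  ultimately have "card ((f \<circ> g) ` ({1..k} - {length xs})) = k - 1"
    by (subst card_image) auto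
  moreover have "(f \<circ> g) ` ({1..k} - {length xs}) \<subseteq> {u. {u, f xs} \<in> forest_edges f b k}"
  proof clarsimp
    fix j assume j: "Suc 0 \<le> j" "j \<le> k" "j \<noteq> length xs"
    have "g j \<in> forest b k"
      using j xs len[of j] set_take_subset[of j xs]
      by (auto simp: forest_def g_def)
    moreover have "strict_prefix (g j) xs \<or> strict_prefix xs (g j)"
    proof (cases "j < length xs")
      case True
      then have "g j = take j xs" by (simp add: g_def)
      then have "prefix (g j) xs" by (simp add: take_is_prefix)
      then show ?thesis using j len[of j] by (auto simp: strict_prefix_def)
    next
      case False
      then have "prefix xs (g j)" by (simp add: g_def)
      then show ?thesis using j len[of j] by (auto simp: strict_prefix_def)
    qed
    ultimately show "{f (g j), f xs} \<in> forest_edges f b k"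
      using xs by (simp add: forest_edge_iff[OF f])
  qed
  moreover have "finite {u. {u, f xs} \<in> forest_edges f b k}"
    using closed_nbhd_subset[OF simple_graph_forest[OF f], of "f xs" b k] xs finite_forest[of b k]
    by (auto simp: closed_nbhd_def intro: finite_subset)
  ultimately show ?thesis
    unfolding degree_def by (metis card_mono)
qed

text \<open>Pigeonhole: the \<open>b + 1\<close> child subtrees of \<open>xs\<close> are disjoint,
  and \<open>X\<close> has at most \<open>b\<close> elements.\<close>

lemma untouched_child:
  assumes f: "inj f" and X: "finite X" "card X \<le> b"
  shows "\<exists>c \<le> b. \<forall>ys. prefix (xs @ [c]) ys \<longrightarrow> f ys \<notin> X"
proof -
  \<comment> \<open>Reads off the child subtree containing a vertex below \<open>xs\<close>.
    Elsewhere the value may be arbitrary, which is harmless since only the size of the image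
    counts.\<close>
  let ?h = "\<lambda>x. inv f x ! length xs"
  have "card (?h ` X) < card {..b}"
    using card_image_le[OF X(1), of ?h] X(2) by simp
  then have "\<not> {..b} \<subseteq> ?h ` X"
    using X(1) by (meson card_mono finite_imageI not_le)
  then obtain c where c: "c \<le> b" "c \<notin> ?h ` X" by auto
  have "f ys \<notin> X" if "prefix (xs @ [c]) ys" for ys
  proof
    assume "f ys \<in> X"
    then have "ys ! length xs \<in> ?h ` X"
      using f by (metis image_eqI inv_f_f)
    moreover have "ys ! length xs = c"
      using that by (auto simp: prefix_def nth_append)
    ultimately show False using c by simp
  qed
  with c show ?thesis by blast
qed

lemma Staller_wins_forest:
  assumes f: "inj f" and k: "k > 0"
  shows "wins_dominator_first (f ` forest b k) (forest_edges f b k) b Staller"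
proof -
  let ?V = "f ` forest b k" and ?E = "forest_edges f b k"
  \<comment> \<open>In a legal play these are Staller's vertices.\<close>
  define S where "S ms = claimed ms - claimed_by Dominator ms" for ms :: "'a set list"
  \<comment> \<open>The position before Dominator moves: Staller owns the path down to
    \<open>xs\<close>, and all below it is free. At the start \<open>xs\<close> is empty, hence no
    membership in the forest is required.\<close>
  define open_below where "open_below ms xs \<longleftrightarrow> set xs \<subseteq> {..b} \<and> length xs \<le> k \<and>
      (\<forall>ys \<in> forest b k. prefix ys xs \<longrightarrow> f ys \<in> S ms) \<and>
      (\<forall>ys \<in> forest b k. strict_prefix xs ys \<longrightarrow> f ys \<notin> claimed ms)" for ms xs
  \<comment> \<open>The position before Staller moves: he owns the path above \<open>xs\<close>,
    while \<open>xs\<close> and its whole subtree are free, so \<open>xs\<close> is his next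
    vertex.\<close>
  define open_at where "open_at ms xs \<longleftrightarrow> xs \<in> forest b k \<and>
      (\<forall>ys \<in> forest b k. strict_prefix ys xs \<longrightarrow> f ys \<in> S ms) \<and>
      (\<forall>ys \<in> forest b k. prefix xs ys \<longrightarrow> f ys \<notin> claimed ms)" for ms xs
  define won where "won ms \<longleftrightarrow> (\<exists>xs \<in> forest b k. length xs = k \<and>
      (\<forall>ys \<in> forest b k. prefix ys xs \<longrightarrow> f ys \<in> S ms))" for ms
  define I where "I ms \<longleftrightarrow> won ms \<or>
      (\<exists>xs. if turn (length ms) = Dominator then open_below ms xs else open_at ms xs)" for ms
  have S_mono: "S ms \<subseteq> S (ms @ [X])" if "legal_play ?V b (ms @ [X])" for ms X
    using that by (auto simp: S_def legal_play_snoc)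
  have won_mono: "won (ms @ [X])" if "legal_play ?V b (ms @ [X])" "won ms" for ms X
    using that S_mono by (fastforce simp: won_def)
  have won_if_full: "won ms" if "open_below ms xs" "length xs = k" for ms xs
    using that k by (auto simp: open_below_def won_def forest_def)
  have extend: "xs @ [c] \<in> forest b k" if "set xs \<subseteq> {..b}" "length xs < k" "c \<le> b" for xs c
    using that by (simp add: forest_def)
  show ?thesis
  proof (rule winning_strategy_if_invariant[of I])
    have "open_below [] []" by (auto simp: open_below_def forest_def)
    then show "I []" by (auto simp: I_def turn_def)
  next
    fix ms X
    assume *: "legal_play ?V b (ms @ [X])" "turn (length ms) \<noteq> Staller" "I ms"
    then have turn: "turn (length ms) = Dominator" by (simp add: player_neq_Staller)
    show "I (ms @ [X])"
    proof (cases "won ms")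
      case True
      then show ?thesis using won_mono[OF *(1)] by (simp add: I_def)
    next
      case False
      then obtain xs where xs: "open_below ms xs" using * turn by (auto simp: I_def)
      then have len: "length xs < k"
        using won_if_full False by (fastforce simp: open_below_def)
      have X: "X \<subseteq> ?V" "card X \<le> b"
        using * turn by (auto simp: legal_play_snoc legal_size_def)
      then have "finite X" using finite_forest finite_subset by blast
      \<comment> \<open>The path will continue into a subtree that Dominator's move has
        missed.\<close>
      from untouched_child[OF f this X(2), of xs] obtain c where
        c: "c \<le> b" "\<And>ys. prefix (xs @ [c]) ys \<Longrightarrow> f ys \<notin> X" by blast
      have "open_at (ms @ [X]) (xs @ [c])"
        unfolding open_at_def
      proof (intro conjI ballI impI)
        show "xs @ [c] \<in> forest b k"
          using xs len c by (intro extend) (auto simp: open_below_def)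
      next
        fix ys assume "ys \<in> forest b k" "strict_prefix ys (xs @ [c])"
        then have "f ys \<in> S ms" using xs by (auto simp: open_below_def strict_prefix_def)
        then show "f ys \<in> S (ms @ [X])" using S_mono[OF *(1)] by blast
      next
        fix ys assume ys: "ys \<in> forest b k" "prefix (xs @ [c]) ys"
        then have "strict_prefix xs ys" by (auto simp: prefix_def strict_prefix_def)
        then show "f ys \<notin> claimed (ms @ [X])"
          using xs ys c(2) by (auto simp: open_below_def)
      qed
      then show ?thesis using turn by (auto simp: I_def turn_def split: if_splits)
    qed
  next
    fix ms
    assume *: "legal_play ?V b ms" "claimed ms \<noteq> ?V" "turn (length ms) = Staller" "I ms"
    have legal: "legal_play ?V b (ms @ [{v}])" if "v \<in> ?V - claimed ms" for v
      using that * by (auto simp: legal_play_snoc legal_size_def)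
    show "\<exists>X. legal_play ?V b (ms @ [X]) \<and> I (ms @ [X])"
    proof (cases "won ms")
      case True
      \<comment> \<open>The path is complete, but Staller must still claim a vertex; any free one
        will do.\<close>
      obtain v where "v \<in> ?V - claimed ms"
        using * legal_play_subset[OF *(1)] by blast
      with True show ?thesis using legal won_mono unfolding I_def by blast
    next
      case False
      then obtain xs where xs: "open_at ms xs" using * by (auto simp: I_def)
      let ?X = "{f xs}"
      have legal': "legal_play ?V b (ms @ [?X])"
        using xs by (intro legal) (auto simp: open_at_def)
      have "open_below (ms @ [?X]) xs"
        unfolding open_below_def
      proof (intro conjI ballI impI)
        show "set xs \<subseteq> {..b}" "length xs \<le> k"
          using xs by (auto simp: open_at_def forest_def)
      next
        fix ys assume ys: "ys \<in> forest b k" "prefix ys xs"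
        show "f ys \<in> S (ms @ [?X])"
        proof (cases "ys = xs")
          case True
          then show ?thesis
            using xs *(3) claimed_by_subset[of Dominator ms] by (auto simp: open_at_def S_def)
        next
          case False
          then show ?thesis
            using xs ys S_mono[OF legal'] by (auto simp: open_at_def strict_prefix_def)
        qed
      next
        fix ys assume ys: "ys \<in> forest b k" "strict_prefix xs ys"
        then show "f ys \<notin> claimed (ms @ [?X])"
          using xs f by (auto simp: open_at_def strict_prefix_def inj_eq)
      qed
      then have "I (ms @ [?X])" using *(3) by (auto simp: I_def turn_Suc)
      with legal' show ?thesis by blast
    qed
  next
    fix ms
    assume *: "finished_play ?V b ms" "I ms"
    then have C: "claimed ms = ?V" by (simp add: finished_play_def)
    have no_at: "\<not> open_at ms xs" for xs
      using C by (auto simp: open_at_def)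
    \<comment> \<open>With no vertex free, the path cannot stop above a leaf: the child
      \<open>xs @ [0]\<close> would be free.\<close>
    have full: "length xs = k" if "open_below ms xs" for xs
    proof (rule ccontr)
      assume "length xs \<noteq> k"
      then have "xs @ [0] \<in> forest b k"
        using that by (intro extend) (auto simp: open_below_def)
      then show False using that C by (auto simp: open_below_def strict_prefix_def)
    qed
    have "won ms"
      using *(2) no_at full won_if_full by (auto simp: I_def split: if_splits)
    then obtain xs where xs: "xs \<in> forest b k" "length xs = k"
      "\<And>ys. ys \<in> forest b k \<Longrightarrow> prefix ys xs \<Longrightarrow> f ys \<notin> claimed_by Dominator ms"
      by (auto simp: won_def S_def)
    have "\<not> dominating_set ?V ?E D" if D: "D \<subseteq> claimed_by Dominator ms" for D
    proof
      assume dom: "dominating_set ?V ?E D"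
      have "f xs \<in> ?V - D" using xs D by auto
      with dom obtain u where u: "u \<in> D" "{u, f xs} \<in> ?E" by (auto simp: dominating_set_def)
      with dom obtain ys where ys: "u = f ys" by (auto simp: dominating_set_def)
      with u have "ys \<in> forest b k" "strict_prefix ys xs \<or> strict_prefix xs ys"
        by (auto simp: forest_edge_iff[OF f])
      \<comment> \<open>A leaf has no proper extension in the forest, so all its neighbours lie on
        Staller's path.\<close>
      moreover from this have "\<not> strict_prefix xs ys"
        using xs(2) prefix_length_less by (fastforce simp: forest_def)
      ultimately show False
        using xs(3) u(1) ys D by (auto simp: strict_prefix_def)
    qed
    then show "won_by ?V ?E Staller ms" by (simp add: won_by_def)
  qed
qed

text \<open>Combines minimum degree at least \<open>k - 1\<close> with order below
  \<open>(b + 1) ^ (k + 1)\<close>; the gap between the two exponents is the 2.\<close>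

lemma forest_min_degree:
  assumes f: "inj f" and "k > 0" and "b > 0"
  shows "real (min_degree (f ` forest b k) (forest_edges f b k))
    > log (real (b + 1)) (real (card (forest b k))) - 2"
proof -
  let ?V = "f ` forest b k" and ?n = "card (forest b k)"
  have n: "?n > 0" using card_forest_ge[of k b] \<open>k > 0\<close> by simp
  then have "?V \<noteq> {}" by auto
  then have "k - 1 \<le> min_degree ?V (forest_edges f b k)"
    using degree_forest_ge[OF f] finite_forest[of b k] by (auto simp: min_degree_def)
  then have "real k - 1 \<le> real (min_degree ?V (forest_edges f b k))"
    using \<open>k > 0\<close> by linarith
  moreover have "log (real (b + 1)) (real ?n) < real (k + 1)"
  proof -
    have "real ?n < real ((b + 1) ^ (k + 1))"
      using card_forest_less[OF \<open>b > 0\<close>, of k] by (subst of_nat_less_iff)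
    also have "\<dots> = real (b + 1) powr real (k + 1)"
      by (subst powr_realpow) (simp_all add: algebra_simps)
    finally show ?thesis
      using n \<open>b > 0\<close> by (subst log_less_iff) auto
  qed
  ultimately show ?thesis by simp
qed

section \<open>The degree bound and its sharpness\<close>

theorem theorem1p8:
  fixes b :: nat
  assumes "b > 0"
  shows "(\<forall>n > 0. \<forall>(V :: 'a set) E.
            simple_graph V E \<and> card V = n \<and>
            real (min_degree V E) > log (real (b + 1)) (real n) - 1
            \<longrightarrow> wins_dominator_first V E b Dominator) \<and>
         infinite {n. n > 0 \<and>
            (\<exists>(V :: nat set) E.
               simple_graph V E \<and> card V = n \<and>
               real (min_degree V E) > log (real (b + 1)) (real n) - 2 \<and>
               wins_dominator_first V E b Staller)}"
    (is "?A \<and> infinite ?M")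
proof
  show ?A
    using Dominator_wins_if_min_degree[OF _ _ assms] by force
  have M: "card (forest b k) \<in> ?M" if "k > 0" for k
  proof -
    \<comment> \<open>An injective numbering of lists turns the forest into a graph on natural
      numbers.\<close>
    have f: "inj list_encode" by (rule inj_list_encode)
    have "card (list_encode ` forest b k) = card (forest b k)"
      using f by (simp add: card_image inj_on_subset[of _ UNIV])
    then show ?thesis
      using card_forest_ge[of k b] that simple_graph_forest[OF f, of b k]
        forest_min_degree[OF f that assms] Staller_wins_forest[OF f that, of b] by auto
  qed
  show "infinite ?M"
  proof
    assume "finite ?M"
    then obtain m where "\<forall>n \<in> ?M. n \<le> m" unfolding finite_nat_set_iff_bounded_le ..
    \<comment> \<open>A forest with more than \<open>m\<close> levels has more than \<open>m\<close>
      vertices, so no bound on the orders exists.\<close>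
    then have "card (forest b (Suc m)) \<le> m" using M[of "Suc m"] by blast
    then show False using card_forest_ge[of "Suc m" b] by simp
  qed
qed

end
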